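(* Any character of $\Gamma_\lambda$ extends to a non-zero right $U_\lambda$-module; that is, for every algebra homomorphism $\chi:\Gamma_\lambda\to\mathbb C$ there exist a right $U_\lambda$-module $M$ and a non-zero element $m\in M$ such that $m\cdot\gamma=\chi(\gamma)m$ for all $\gamma\in\Gamma_\lambda$.
   Context: Let $k\ge 1$ and let $\lambda=(\lambda_1,\dots,\lambda_k)$ be positive integers. Let $I$ be the set of pairs $(i,j)$ with $1\le i\le k$, $1\le j\le \lambda_i$; for $1\le i\le k$ let $I^{(i)}=\{(i,j):1\le j\le\lambda_i\}$, and put $I^{(0)}=\emptyset$ (a product over the empty set is $1$). Let $\Omega=\mathbb{C}(x_{\mathbf a}:\mathbf a\in I)$. For $\mathbf a\in I$, $\varphi_{\mathbf a}$ is the $\mathbb{C}$-automorphism of the field $\Omega$ with $\varphi_{\mathbf a}(x_{\mathbf b})=x_{\mathbf b}+\delta_{\mathbf a,\mathbf b}$. Elements of $\Omega$ act on $\Omega$ by multiplication. For $i=1,\dots,k-1$ define operators on $\Omega$ $$E_i=\sum_{j=1}^{\lambda_i}\frac{\prod_{\mathbf a\in I^{(i+1)}}(x_{(i,j)}-x_{\mathbf a})}{\prod_{\mathbf b\in I^{(i)}\setminus\{(i,j)\}}(x_{(i,j)}-x_{\mathbf b})}\varphi_{(i,j)},\qquad F_i=\sum_{j=1}^{\lambda_i}\frac{\prod_{\mathbf a\in I^{(i-1)}}(x_{(i,j)}-x_{\mathbf a})}{\prod_{\mathbf b\in I^{(i)}\setminus\{(i,j)\}}(x_{(i,j)}-x_{\mathbf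 b})}\varphi_{(i,j)}^{-1}.$$ For $\mathbf a=(i,j)\in I$, $\gamma_{\mathbf a}$ is multiplication by the $j$-th elementary symmetric polynomial in $\{x_{\mathbf b}:\mathbf b\in I^{(i)}\}$. The orthogonal Gelfand-Zeitlin algebra $U_\lambda$ is the algebra of $\mathbb{C}$-linear transformations of $\Omega$ generated by all $E_i,F_i$ ($1\le i\le k-1$) and all $\gamma_{\mathbf a}$ ($\mathbf a\in I$). Its Gelfand-Zeitlin subalgebra $\Gamma_\lambda$ is the commutative subalgebra generated by all $\gamma_{\mathbf a}$. A character of $\Gamma_\lambda$ is a unital $\mathbb{C}$-algebra homomorphism $\Gamma_\lambda\to\mathbb C$. *)

theory Defs
  imports
    Complex_Main
    "HOL-Library.Poly_Mapping"
    "HOL-Library.Product_Lexorder"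
    "HOL-Library.FuncSet"
    "HOL-Computational_Algebra.Fraction_Field"
    "HOL-Algebra.Generated_Rings"
    "HOL-Algebra.Algebraic_Closure_Type"
begin

section \<open>Rational functions\<close>

text \<open>
  Polynomials and rational functions over the complex numbers in variables indexed by all pairs
  of natural numbers; the field of rational functions in the variables from a given set is cut
  out below as a carrier set. The lexicographic order on pairs is only needed for the
  \<^class>\<open>idom\<close> instance of \<^typ>\<open>'a \<Rightarrow>\<^sub>0 'b\<close>.
\<close>

type_synonym idx = "nat \<times> nat"
type_synonym mpol = "(idx \<Rightarrow>\<^sub>0 nat) \<Rightarrow>\<^sub>0 complex"
type_synonym rfun = "mpol fract"

definition pconst :: "complex \<Rightarrow> mpol" where
  "pconst c = Poly_Mapping.single 0 c"

definition pvar :: "idx \<Rightarrow> mpol" where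
  "pvar a = Poly_Mapping.single (Poly_Mapping.single a 1) 1"

definition pvars :: "mpol \<Rightarrow> idx set" where
  "pvars p = (\<Union>m\<in>Poly_Mapping.keys p. Poly_Mapping.keys m)"

definition rconst :: "complex \<Rightarrow> rfun" where
  "rconst c = Fract (pconst c) 1"

definition rvar :: "idx \<Rightarrow> rfun" where
  "rvar a = Fract (pvar a) 1"

definition rat_funs :: "idx set \<Rightarrow> rfun set" where
  "rat_funs A = {Fract p q | p q. q \<noteq> 0 \<and> pvars p \<subseteq> A \<and> pvars q \<subseteq> A}"


section \<open>The shift automorphisms\<close>

definition mono_subst :: "(idx \<Rightarrow> mpol) \<Rightarrow> (idx \<Rightarrow>\<^sub>0 nat) \<Rightarrow> mpol" where
  "mono_subst \<sigma> m = (\<Prod>b\<in>Poly_Mapping.keys m. \<sigma> b ^ Poly_Mapping.lookup m b)"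

definition poly_subst :: "(idx \<Rightarrow> mpol) \<Rightarrow> mpol \<Rightarrow> mpol" where
  "poly_subst \<sigma> p =
     (\<Sum>m\<in>Poly_Mapping.keys p. pconst (Poly_Mapping.lookup p m) * mono_subst \<sigma> m)"

definition translate_poly :: "idx \<Rightarrow> complex \<Rightarrow> mpol \<Rightarrow> mpol" where
  "translate_poly a c = poly_subst (\<lambda>b. pvar b + pconst (if a = b then c else 0))"

lemma pconst_add: "pconst (c + d) = pconst c + pconst d"
  by (simp add: pconst_def single_add)

lemma pconst_mult: "pconst (c * d) = pconst c * pconst d"
  by (simp add: pconst_def mult_single)

lemma pconst_0 [simp]: "pconst 0 = 0" and pconst_1 [simp]: "pconst 1 = 1"
  by (simp_all add: pconst_def)

lemma mono_subst_superset:
  assumes "finite A" "Poly_Mapping.keys m \<subseteq> A"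
  shows "mono_subst \<sigma> m = (\<Prod>b\<in>A. \<sigma> b ^ Poly_Mapping.lookup m b)"
  unfolding mono_subst_def using assms
  by (intro prod.mono_neutral_left) (auto simp: in_keys_iff)

lemma mono_subst_0 [simp]: "mono_subst \<sigma> 0 = 1"
  by (simp add: mono_subst_def)

lemma mono_subst_add: "mono_subst \<sigma> (m + n) = mono_subst \<sigma> m * mono_subst \<sigma> n"
proof -
  let ?A = "Poly_Mapping.keys m \<union> Poly_Mapping.keys n"
  have "Poly_Mapping.keys (m + n) \<subseteq> ?A" by (rule Poly_Mapping.keys_add)
  then show ?thesis
    by (simp add: mono_subst_superset[of ?A] lookup_add power_add prod.distrib)
qed

lemma poly_subst_superset:
  assumes "finite A" "Poly_Mapping.keys p \<subseteq> A"
  shows "poly_subst \<sigma> p = (\<Sum>m\<in>A. pconst (Poly_Mapping.lookup p m) * mono_subst \<sigma> m)"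
  unfolding poly_subst_def using assms
  by (intro sum.mono_neutral_left) (auto simp: in_keys_iff)

lemma poly_subst_add: "poly_subst \<sigma> (p + q) = poly_subst \<sigma> p + poly_subst \<sigma> q"
proof -
  let ?A = "Poly_Mapping.keys p \<union> Poly_Mapping.keys q"
  have "Poly_Mapping.keys (p + q) \<subseteq> ?A" by (rule Poly_Mapping.keys_add)
  then show ?thesis
    by (simp add: poly_subst_superset[of ?A] lookup_add pconst_add sum.distrib algebra_simps)
qed

lemma poly_subst_0 [simp]: "poly_subst \<sigma> 0 = 0"
  by (simp add: poly_subst_def)

lemma poly_subst_single: "poly_subst \<sigma> (Poly_Mapping.single m c) = pconst c * mono_subst \<sigma> m"
  by (cases "c = 0") (simp_all add: poly_subst_def)

lemma poly_subst_1 [simp]: "poly_subst \<sigma> 1 = 1"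
  using poly_subst_single[of \<sigma> 0 1] by simp

lemma poly_subst_pconst [simp]: "poly_subst \<sigma> (pconst c) = pconst c"
  unfolding pconst_def poly_subst_single by (simp add: pconst_def)

lemma poly_subst_pvar [simp]: "poly_subst \<sigma> (pvar a) = \<sigma> a"
  unfolding pvar_def poly_subst_single by (simp add: mono_subst_def)

lemma poly_subst_sum: "poly_subst \<sigma> (sum f A) = (\<Sum>i\<in>A. poly_subst \<sigma> (f i))"
  by (induction A rule: infinite_finite_induct) (auto simp: poly_subst_add)

lemma mpol_eq_sum_single:
  "(p :: mpol) = (\<Sum>m\<in>Poly_Mapping.keys p. Poly_Mapping.single m (Poly_Mapping.lookup p m))"
proof (rule poly_mapping_eqI)
  fix n
  show "Poly_Mapping.lookup p n = Poly_Mapping.lookup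
      (\<Sum>m\<in>Poly_Mapping.keys p. Poly_Mapping.single m (Poly_Mapping.lookup p m)) n"
    by (simp add: lookup_sum lookup_single when_def in_keys_iff sum.delta)
qed

lemma mpol_induct [case_names single add]:
  assumes "\<And>m c. P (Poly_Mapping.single m c)"
  assumes "\<And>p q. P p \<Longrightarrow> P q \<Longrightarrow> P (p + q)"
  shows "P (p :: mpol)"
proof -
  have "P (\<Sum>m\<in>A. Poly_Mapping.single m (f m))" for A :: "(idx \<Rightarrow>\<^sub>0 nat) set" and f
  proof (induction A rule: infinite_finite_induct)
    case (insert x F)
    then show ?case using assms by simp
  qed (use assms(1)[of 0 0] in simp_all)
  then show ?thesis by (subst mpol_eq_sum_single)
qed

lemma poly_subst_mult: "poly_subst \<sigma> (p * q) = poly_subst \<sigma> p * poly_subst \<sigma> q"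
proof (induction p rule: mpol_induct)
  case (single m c)
  show ?case
  proof (induction q rule: mpol_induct)
    case (single n d)
    show ?case
      by (simp add: mult_single poly_subst_single mono_subst_add pconst_mult algebra_simps)
  qed (simp add: poly_subst_add distrib_left)
qed (simp add: poly_subst_add distrib_right)

lemma poly_subst_power: "poly_subst \<sigma> (p ^ n) = poly_subst \<sigma> p ^ n"
  by (induction n) (auto simp: poly_subst_mult)

lemma poly_subst_prod: "poly_subst \<sigma> (prod f A) = (\<Prod>i\<in>A. poly_subst \<sigma> (f i))"
  by (induction A rule: infinite_finite_induct) (auto simp: poly_subst_mult)

lemma prod_single:
  "finite A \<Longrightarrow>
    (\<Prod>b\<in>A. Poly_Mapping.single (g b) (1::complex)) = Poly_Mapping.single (\<Sum>b\<in>A. g b) 1"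
  by (induction A rule: finite_induct) (auto simp: mult_single)

lemma power_single:
  "Poly_Mapping.single (Poly_Mapping.single a (1::nat)) (1::complex) ^ n
    = Poly_Mapping.single (Poly_Mapping.single a n) 1"
  by (induction n) (auto simp: mult_single single_add[symmetric])

lemma mono_subst_pvar: "mono_subst pvar m = Poly_Mapping.single m 1"
proof -
  have "m = (\<Sum>b\<in>Poly_Mapping.keys m. Poly_Mapping.single b (Poly_Mapping.lookup m b))"
    by (rule poly_mapping_eqI) (simp add: lookup_sum lookup_single when_def in_keys_iff sum.delta)
  then show ?thesis
    unfolding mono_subst_def pvar_def power_single by (simp add: prod_single)
qed

lemma single_conv_pvar: "Poly_Mapping.single m c = pconst c * mono_subst pvar m"
  by (simp add: mono_subst_pvar pconst_def mult_single)

lemma translate_poly_inverse: "translate_poly a (- c) (translate_poly a c p) = p"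
proof (induction p rule: mpol_induct)
  case (single m d)
  have "translate_poly a (- c) (pvar b + pconst (if a = b then c else 0)) = pvar b" for b
    by (simp add: translate_poly_def poly_subst_add add.assoc flip: pconst_add)
  then show ?case
    unfolding single_conv_pvar
    by (simp add: translate_poly_def poly_subst_mult mono_subst_def poly_subst_prod
        poly_subst_power)
qed (simp add: translate_poly_def poly_subst_add)

lemma translate_poly_eq_0_iff [simp]: "translate_poly a c p = 0 \<longleftrightarrow> p = 0"
  by (metis translate_poly_inverse poly_subst_0 translate_poly_def)

definition translate :: "idx \<Rightarrow> complex \<Rightarrow> rfun \<Rightarrow> rfun" where
  "translate a c f = (THE g. \<forall>p q. q \<noteq> 0 \<longrightarrow> f = Fract p q \<longrightarrow>
     g = Fract (translate_poly a c p) (translate_poly a c q))"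

definition phi :: "idx \<Rightarrow> rfun \<Rightarrow> rfun" where
  "phi a = translate a 1"

lemma translate_Fract:
  "q \<noteq> 0 \<Longrightarrow> translate a c (Fract p q) = Fract (translate_poly a c p) (translate_poly a c q)"
proof -
  assume q: "q \<noteq> 0"
  have mult: "translate_poly a c (r * s) = translate_poly a c r * translate_poly a c s" for r s
    by (simp add: translate_poly_def poly_subst_mult)
  have "Fract (translate_poly a c p) (translate_poly a c q)
      = Fract (translate_poly a c r) (translate_poly a c s)"
    if "s \<noteq> 0" "Fract p q = Fract r s" for r s
    using that q by (simp add: eq_fract flip: mult)
  then show ?thesis
    unfolding translate_def using q by (intro the_equality) blast+
qed

lemma translate_inverse: "translate a (- c) (translate a c f) = f"
  by (cases f) (simp add: translate_Fract translate_poly_inverse)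

lemma translate_add: "translate a c (f + g) = translate a c f + translate a c g"
proof (cases f; cases g)
  fix p q r s assume "f = Fract p q" "q \<noteq> 0" "g = Fract r s" "s \<noteq> 0"
  moreover from this have "translate_poly a c q \<noteq> 0" "translate_poly a c s \<noteq> 0" by simp_all
  ultimately show ?thesis
    by (simp add: translate_Fract) (simp add: translate_poly_def poly_subst_add poly_subst_mult)
qed

lemma translate_mult: "translate a c (f * g) = translate a c f * translate a c g"
  by (cases f; cases g)
     (simp add: translate_Fract, simp add: translate_poly_def poly_subst_mult)

lemma phi_add: "phi a (f + g) = phi a f + phi a g"
  and phi_mult: "phi a (f * g) = phi a f * phi a g"
  by (simp_all add: phi_def translate_add translate_mult)

lemma phi_rconst: "phi a (rconst c) = rconst c"
  by (simp add: phi_def rconst_def translate_Fract) (simp add: translate_poly_def)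

lemma phi_rvar: "phi a (rvar b) = rvar b + (if a = b then 1 else 0)"
  by (simp add: phi_def rvar_def translate_Fract) (simp add: translate_poly_def One_fract_def)

lemma bij_phi: "bij (phi a)"
proof (rule o_bij)
  show "translate a (- 1) \<circ> phi a = id"
    by (auto simp: phi_def translate_inverse)
  show "phi a \<circ> translate a (- 1) = id"
    using translate_inverse[of a "- 1"] by (auto simp: phi_def)
qed

lemma inv_phi: "inv_into UNIV (phi a) = translate a (- 1)"
proof (rule Hilbert_Choice.inv_equality)
  show "translate a (- 1) (phi a f) = f" for f by (simp add: phi_def translate_inverse)
  show "phi a (translate a (- 1) f) = f" for f
    using translate_inverse[of a "- 1"] by (simp add: phi_def)
qed


lemma pvars_add: "pvars (p + q) \<subseteq> pvars p \<union> pvars q"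
  using Poly_Mapping.keys_add[of p q] by (auto simp: pvars_def)

lemma pvars_mult: "pvars (p * q) \<subseteq> pvars p \<union> pvars q"
proof
  fix b assume "b \<in> pvars (p * q)"
  then obtain m where "m \<in> Poly_Mapping.keys (p * q)" and b: "b \<in> Poly_Mapping.keys m"
    by (auto simp: pvars_def)
  then obtain n l where "m = n + l" "n \<in> Poly_Mapping.keys p" "l \<in> Poly_Mapping.keys q"
    using keys_mult[of p q] by auto
  with b show "b \<in> pvars p \<union> pvars q"
    using Poly_Mapping.keys_add[of n l] by (auto simp: pvars_def)
qed

lemma pvars_pconst [simp]: "pvars (pconst c) = {}"
  by (simp add: pvars_def pconst_def)

lemma pvars_0 [simp]: "pvars 0 = {}" and pvars_1 [simp]: "pvars 1 = {}"
  using pvars_pconst[of 0] pvars_pconst[of 1] by simp_all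

lemma pvars_pvar [simp]: "pvars (pvar a) = {a}"
  by (simp add: pvars_def pvar_def)

lemma pvars_uminus [simp]: "pvars (- p) = pvars p"
  by (simp add: pvars_def)

lemma pvars_power: "pvars p \<subseteq> A \<Longrightarrow> pvars (p ^ n) \<subseteq> A"
  by (induction n) (use pvars_mult in fastforce)+

lemma pvars_prod: "(\<And>i. i \<in> B \<Longrightarrow> pvars (f i) \<subseteq> A) \<Longrightarrow> pvars (prod f B) \<subseteq> A"
proof (induction B rule: infinite_finite_induct)
  case (insert x F)
  then show ?case using pvars_mult[of "f x" "prod f F"] by auto
qed auto

lemma pvars_sum: "(\<And>i. i \<in> B \<Longrightarrow> pvars (f i) \<subseteq> A) \<Longrightarrow> pvars (sum f B) \<subseteq> A"
proof (induction B rule: infinite_finite_induct)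
  case (insert x F)
  then show ?case using pvars_add[of "f x" "sum f F"] by auto
qed auto

lemma pvars_poly_subst:
  assumes "\<And>b. b \<in> pvars p \<Longrightarrow> pvars (\<sigma> b) \<subseteq> A"
  shows "pvars (poly_subst \<sigma> p) \<subseteq> A"
  unfolding poly_subst_def
proof (rule pvars_sum)
  fix m assume "m \<in> Poly_Mapping.keys p"
  then have "pvars (mono_subst \<sigma> m) \<subseteq> A"
    unfolding mono_subst_def using assms
    by (intro pvars_prod pvars_power) (auto simp: pvars_def)
  then show "pvars (pconst (Poly_Mapping.lookup p m) * mono_subst \<sigma> m) \<subseteq> A"
    using pvars_mult[of "pconst (Poly_Mapping.lookup p m)" "mono_subst \<sigma> m"] by auto
qed

lemma pvars_translate_poly:
  assumes "pvars p \<subseteq> A"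
  shows "pvars (translate_poly a c p) \<subseteq> A"
  unfolding translate_poly_def
proof (rule pvars_poly_subst)
  fix b assume "b \<in> pvars p"
  then show "pvars (pvar b + pconst (if a = b then c else 0)) \<subseteq> A"
    using assms pvars_add[of "pvar b" "pconst (if a = b then c else 0)"]
    by (auto simp del: pconst_0)
qed

lemma rat_funsI: "q \<noteq> 0 \<Longrightarrow> pvars p \<subseteq> A \<Longrightarrow> pvars q \<subseteq> A \<Longrightarrow> Fract p q \<in> rat_funs A"
  by (auto simp: rat_funs_def)

lemma rat_funsE:
  assumes "f \<in> rat_funs A"
  obtains p q where "f = Fract p q" "q \<noteq> 0" "pvars p \<subseteq> A" "pvars q \<subseteq> A"
  using assms by (auto simp: rat_funs_def)

lemma rat_funs_rconst [simp]: "rconst c \<in> rat_funs A"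
  unfolding rconst_def by (rule rat_funsI) auto

lemma rat_funs_rvar: "a \<in> A \<Longrightarrow> rvar a \<in> rat_funs A"
  unfolding rvar_def by (rule rat_funsI) auto

lemma rconst_0 [simp]: "rconst 0 = 0" and rconst_1 [simp]: "rconst 1 = 1"
  by (simp_all add: rconst_def Zero_fract_def One_fract_def)

lemma rat_funs_0 [simp]: "0 \<in> rat_funs A" and rat_funs_1 [simp]: "1 \<in> rat_funs A"
  using rat_funs_rconst[of 0 A] rat_funs_rconst[of 1 A] by simp_all

lemma rat_funs_add: "f \<in> rat_funs A \<Longrightarrow> g \<in> rat_funs A \<Longrightarrow> f + g \<in> rat_funs A"
proof (elim rat_funsE)
  fix p q r s
  assume "f = Fract p q" "q \<noteq> 0" "pvars p \<subseteq> A" "pvars q \<subseteq> A"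
    "g = Fract r s" "s \<noteq> 0" "pvars r \<subseteq> A" "pvars s \<subseteq> A"
  then show "f + g \<in> rat_funs A"
    using pvars_add[of "p * s" "r * q"] pvars_mult[of p s] pvars_mult[of r q] pvars_mult[of q s]
    by (simp, intro rat_funsI) (simp, blast+)
qed

lemma rat_funs_mult: "f \<in> rat_funs A \<Longrightarrow> g \<in> rat_funs A \<Longrightarrow> f * g \<in> rat_funs A"
proof (elim rat_funsE)
  fix p q r s
  assume "f = Fract p q" "q \<noteq> 0" "pvars p \<subseteq> A" "pvars q \<subseteq> A"
    "g = Fract r s" "s \<noteq> 0" "pvars r \<subseteq> A" "pvars s \<subseteq> A"
  then show "f * g \<in> rat_funs A"
    using pvars_mult[of p r] pvars_mult[of q s] by (auto intro!: rat_funsI)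
qed

lemma rat_funs_uminus: "f \<in> rat_funs A \<Longrightarrow> - f \<in> rat_funs A"
  by (elim rat_funsE) (auto intro!: rat_funsI)

lemma rat_funs_diff: "f \<in> rat_funs A \<Longrightarrow> g \<in> rat_funs A \<Longrightarrow> f - g \<in> rat_funs A"
  using rat_funs_add[of f A "- g"] rat_funs_uminus[of g A] by simp

lemma rat_funs_inverse: "f \<in> rat_funs A \<Longrightarrow> inverse f \<in> rat_funs A"
proof (elim rat_funsE)
  fix p q
  assume "f = Fract p q" "q \<noteq> 0" "pvars p \<subseteq> A" "pvars q \<subseteq> A"
  then show "inverse f \<in> rat_funs A"
    by (cases "p = 0") (auto intro!: rat_funsI simp: fract_collapse)
qed

lemma rat_funs_divide: "f \<in> rat_funs A \<Longrightarrow> g \<in> rat_funs A \<Longrightarrow> f / g \<in> rat_funs A"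
  by (simp add: divide_inverse rat_funs_mult rat_funs_inverse)

lemma rat_funs_prod: "(\<And>i. i \<in> B \<Longrightarrow> f i \<in> rat_funs A) \<Longrightarrow> prod f B \<in> rat_funs A"
  by (induction B rule: infinite_finite_induct) (auto intro: rat_funs_mult)

lemma rat_funs_sum: "(\<And>i. i \<in> B \<Longrightarrow> f i \<in> rat_funs A) \<Longrightarrow> sum f B \<in> rat_funs A"
  by (induction B rule: infinite_finite_induct) (auto intro: rat_funs_add)

lemma translate_rat_funs: "f \<in> rat_funs A \<Longrightarrow> translate a c f \<in> rat_funs A"
  by (elim rat_funsE) (auto simp: translate_Fract intro!: rat_funsI dest: pvars_translate_poly)

lemma phi_rat_funs: "phi a ` rat_funs A = rat_funs A"
proof
  show "phi a ` rat_funs A \<subseteq> rat_funs A"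
    by (auto simp: phi_def translate_rat_funs)
  show "rat_funs A \<subseteq> phi a ` rat_funs A"
  proof
    fix f assume "f \<in> rat_funs A"
    then have "translate a (- 1) f \<in> rat_funs A" by (rule translate_rat_funs)
    moreover have "f = phi a (translate a (- 1) f)"
      using translate_inverse[of a "- 1" f] by (simp add: phi_def)
    ultimately show "f \<in> phi a ` rat_funs A" by blast
  qed
qed


section \<open>The ring of linear transformations\<close>

text \<open>
  \<open>\<Omega>\<close> is a carrier set inside the type of rational functions, so transformations of \<open>\<Omega>\<close> are
  normalised to \<^const>\<open>undefined\<close> outside of it.
\<close>

definition End_ring :: "rfun set \<Rightarrow> (rfun \<Rightarrow> rfun) ring" where
  "End_ring \<Omega> = \<lparr>
     carrier = {T \<in> \<Omega> \<rightarrow>\<^sub>E \<Omega>.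
       (\<forall>f\<in>\<Omega>. \<forall>g\<in>\<Omega>. T (f + g) = T f + T g) \<and>
       (\<forall>c. \<forall>f\<in>\<Omega>. T (rconst c * f) = rconst c * T f)},
     monoid.mult = (\<lambda>S T. compose \<Omega> S T),
     one = (\<lambda>f\<in>\<Omega>. f),
     ring.zero = (\<lambda>f\<in>\<Omega>. 0),
     add = (\<lambda>S T. \<lambda>f\<in>\<Omega>. S f + T f)\<rparr>"

definition mult_op :: "rfun set \<Rightarrow> rfun \<Rightarrow> rfun \<Rightarrow> rfun" where
  "mult_op \<Omega> g = (\<lambda>f\<in>\<Omega>. g * f)"

definition scalar_op :: "rfun set \<Rightarrow> complex \<Rightarrow> rfun \<Rightarrow> rfun" where
  "scalar_op \<Omega> c = mult_op \<Omega> (rconst c)"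

text \<open>A unital complex subalgebra is the same as a subring containing all scalars.\<close>

definition subalgebra_gen :: "rfun set \<Rightarrow> (rfun \<Rightarrow> rfun) set \<Rightarrow> (rfun \<Rightarrow> rfun) ring" where
  "subalgebra_gen \<Omega> S =
     (End_ring \<Omega>)\<lparr>carrier := generate_ring (End_ring \<Omega>) (range (scalar_op \<Omega>) \<union> S)\<rparr>"


lemma End_ring_simps:
  "carrier (End_ring \<Omega>) = {T \<in> \<Omega> \<rightarrow>\<^sub>E \<Omega>.
     (\<forall>f\<in>\<Omega>. \<forall>g\<in>\<Omega>. T (f + g) = T f + T g) \<and>
     (\<forall>c. \<forall>f\<in>\<Omega>. T (rconst c * f) = rconst c * T f)}"
  "S \<otimes>\<^bsub>End_ring \<Omega>\<^esub> T = compose \<Omega> S T"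
  "\<one>\<^bsub>End_ring \<Omega>\<^esub> = (\<lambda>f\<in>\<Omega>. f)"
  "\<zero>\<^bsub>End_ring \<Omega>\<^esub> = (\<lambda>f\<in>\<Omega>. 0)"
  "S \<oplus>\<^bsub>End_ring \<Omega>\<^esub> T = (\<lambda>f\<in>\<Omega>. S f + T f)"
  by (simp_all add: End_ring_def)

lemma End_ringI:
  assumes "\<And>f. f \<in> \<Omega> \<Longrightarrow> T f \<in> \<Omega>"
    and "\<And>f g. f \<in> \<Omega> \<Longrightarrow> g \<in> \<Omega> \<Longrightarrow> f + g \<in> \<Omega>"
    and "\<And>c f. f \<in> \<Omega> \<Longrightarrow> rconst c * f \<in> \<Omega>"
    and "\<And>f g. f \<in> \<Omega> \<Longrightarrow> g \<in> \<Omega> \<Longrightarrow> T (f + g) = T f + T g"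
    and "\<And>c f. f \<in> \<Omega> \<Longrightarrow> T (rconst c * f) = rconst c * T f"
  shows "(\<lambda>f\<in>\<Omega>. T f) \<in> carrier (End_ring \<Omega>)"
  using assms by (auto simp: End_ring_simps)

lemma ring_End_ring: "ring (End_ring (rat_funs A))"
proof -
  let ?\<Omega> = "rat_funs A"
  note cl = rat_funs_add rat_funs_mult[OF rat_funs_rconst]
  have ext: "S = T" if "S \<in> carrier (End_ring ?\<Omega>)" "T \<in> carrier (End_ring ?\<Omega>)"
    "\<And>f. f \<in> ?\<Omega> \<Longrightarrow> S f = T f" for S T
    using that by (auto simp: End_ring_simps intro: PiE_ext)
  have cod [simp]: "T f \<in> ?\<Omega>" if "T \<in> carrier (End_ring ?\<Omega>)" "f \<in> ?\<Omega>" for T f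
    using that by (auto simp: End_ring_simps)
  have lin: "T (f + g) = T f + T g"
    if "T \<in> carrier (End_ring ?\<Omega>)" "f \<in> ?\<Omega>" "g \<in> ?\<Omega>" for T f g
    using that by (auto simp: End_ring_simps)
  have sc: "T (rconst c * f) = rconst c * T f"
    if "T \<in> carrier (End_ring ?\<Omega>)" "f \<in> ?\<Omega>" for T c f
    using that by (auto simp: End_ring_simps)
  have add: "S \<oplus>\<^bsub>End_ring ?\<Omega>\<^esub> T \<in> carrier (End_ring ?\<Omega>)"
    if "S \<in> carrier (End_ring ?\<Omega>)" "T \<in> carrier (End_ring ?\<Omega>)" for S T
    unfolding End_ring_simps(5)
    by (rule End_ringI) (simp_all add: that cl lin sc rat_funs_add distrib_left add_ac)
  have mult: "S \<otimes>\<^bsub>End_ring ?\<Omega>\<^esub> T \<in> carrier (End_ring ?\<Omega>)"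
    if "S \<in> carrier (End_ring ?\<Omega>)" "T \<in> carrier (End_ring ?\<Omega>)" for S T
    unfolding End_ring_simps(2) compose_def
    by (rule End_ringI) (simp_all add: that cl lin sc)
  have zero: "\<zero>\<^bsub>End_ring ?\<Omega>\<^esub> \<in> carrier (End_ring ?\<Omega>)"
    unfolding End_ring_simps(4) by (rule End_ringI) (auto simp: cl)
  have one: "\<one>\<^bsub>End_ring ?\<Omega>\<^esub> \<in> carrier (End_ring ?\<Omega>)"
    unfolding End_ring_simps(3) by (rule End_ringI) (auto simp: cl)
  have ev [simp]: "(S \<oplus>\<^bsub>End_ring ?\<Omega>\<^esub> T) f = S f + T f" "(S \<otimes>\<^bsub>End_ring ?\<Omega>\<^esub> T) f = S (T f)"
    "\<zero>\<^bsub>End_ring ?\<Omega>\<^esub> f = 0" "\<one>\<^bsub>End_ring ?\<Omega>\<^esub> f = f" if "f \<in> ?\<Omega>" for S T f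
    using that by (simp_all add: End_ring_simps compose_def)
  show ?thesis
  proof (rule ringI)
    show "abelian_group (End_ring ?\<Omega>)"
    proof (rule abelian_groupI)
      fix T assume T: "T \<in> carrier (End_ring ?\<Omega>)"
      let ?N = "\<lambda>f\<in>?\<Omega>. - T f"
      have N: "?N \<in> carrier (End_ring ?\<Omega>)"
        by (rule End_ringI) (simp_all add: T cl lin sc rat_funs_uminus)
      then have "?N \<oplus>\<^bsub>End_ring ?\<Omega>\<^esub> T = \<zero>\<^bsub>End_ring ?\<Omega>\<^esub>"
        by (intro ext add zero T) auto
      with N show "\<exists>S\<in>carrier (End_ring ?\<Omega>). S \<oplus>\<^bsub>End_ring ?\<Omega>\<^esub> T = \<zero>\<^bsub>End_ring ?\<Omega>\<^esub>"
        by blast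
    qed (auto intro!: add zero ext simp: algebra_simps)
    show "Group.monoid (End_ring ?\<Omega>)"
      by (rule monoidI) (auto intro!: mult one ext)
  qed (auto intro!: add mult ext simp: lin)
qed

lemma mult_op_in_End: "g \<in> rat_funs A \<Longrightarrow> mult_op (rat_funs A) g \<in> carrier (End_ring (rat_funs A))"
  unfolding mult_op_def by (rule End_ringI) (auto simp: rat_funs_add rat_funs_mult algebra_simps)

lemma scalar_op_in_End: "scalar_op (rat_funs A) c \<in> carrier (End_ring (rat_funs A))"
  unfolding scalar_op_def by (rule mult_op_in_End) simp

lemma ring_subalgebra_gen:
  assumes "S \<subseteq> carrier (End_ring (rat_funs A))"
  shows "ring (subalgebra_gen (rat_funs A) S)"
  unfolding subalgebra_gen_def
  by (rule ring.generate_ring_is_ring[OF ring_End_ring])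
     (use assms in \<open>auto simp: scalar_op_in_End\<close>)


section \<open>Orthogonal Gelfand-Zeitlin algebras\<close>

definition index_set :: "nat \<Rightarrow> (nat \<Rightarrow> nat) \<Rightarrow> idx set" where
  "index_set k lam = {(i, j). 1 \<le> i \<and> i \<le> k \<and> 1 \<le> j \<and> j \<le> lam i}"

definition row :: "(nat \<Rightarrow> nat) \<Rightarrow> nat \<Rightarrow> idx set" where
  "row lam i = (if i = 0 then {} else {(i, j) | j. 1 \<le> j \<and> j \<le> lam i})"

definition Omega :: "nat \<Rightarrow> (nat \<Rightarrow> nat) \<Rightarrow> rfun set" where
  "Omega k lam = rat_funs (index_set k lam)"

definition E_op :: "nat \<Rightarrow> (nat \<Rightarrow> nat) \<Rightarrow> nat \<Rightarrow> rfun \<Rightarrow> rfun" where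
  "E_op k lam i = (\<lambda>f\<in>Omega k lam. \<Sum>j=1..lam i.
     (\<Prod>a\<in>row lam (i + 1). rvar (i, j) - rvar a) /
     (\<Prod>b\<in>row lam i - {(i, j)}. rvar (i, j) - rvar b) * phi (i, j) f)"

definition F_op :: "nat \<Rightarrow> (nat \<Rightarrow> nat) \<Rightarrow> nat \<Rightarrow> rfun \<Rightarrow> rfun" where
  "F_op k lam i = (\<lambda>f\<in>Omega k lam. \<Sum>j=1..lam i.
     (\<Prod>a\<in>row lam (i - 1). rvar (i, j) - rvar a) /
     (\<Prod>b\<in>row lam i - {(i, j)}. rvar (i, j) - rvar b) * inv_into UNIV (phi (i, j)) f)"

definition elem_sym :: "nat \<Rightarrow> idx set \<Rightarrow> rfun" where
  "elem_sym j A = (\<Sum>S | S \<subseteq> A \<and> card S = j. \<Prod>b\<in>S. rvar b)"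

definition gamma_op :: "nat \<Rightarrow> (nat \<Rightarrow> nat) \<Rightarrow> idx \<Rightarrow> rfun \<Rightarrow> rfun" where
  "gamma_op k lam = (\<lambda>(i, j). mult_op (Omega k lam) (elem_sym j (row lam i)))"

definition OGZ :: "nat \<Rightarrow> (nat \<Rightarrow> nat) \<Rightarrow> (rfun \<Rightarrow> rfun) ring" where
  "OGZ k lam = subalgebra_gen (Omega k lam)
     (E_op k lam ` {1..<k} \<union> F_op k lam ` {1..<k} \<union> gamma_op k lam ` index_set k lam)"

definition GZ_sub :: "nat \<Rightarrow> (nat \<Rightarrow> nat) \<Rightarrow> (rfun \<Rightarrow> rfun) ring" where
  "GZ_sub k lam = subalgebra_gen (Omega k lam) (gamma_op k lam ` index_set k lam)"

lemma row_subset: "1 \<le> i \<Longrightarrow> i \<le> k \<Longrightarrow> row lam i \<subseteq> index_set k lam"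
  by (auto simp: row_def index_set_def)

lemma rvar_Omega: "a \<in> index_set k lam \<Longrightarrow> rvar a \<in> Omega k lam"
  by (simp add: Omega_def rat_funs_rvar)

lemma row_prod_in_Omega:
  assumes "i \<le> k" "B \<subseteq> row lam i" "a \<in> index_set k lam"
  shows "(\<Prod>b\<in>B. rvar a - rvar b) \<in> Omega k lam"
proof (cases "i = 0")
  case True
  with assms show ?thesis by (auto simp: row_def Omega_def)
next
  case False
  with assms row_subset[of i k lam] have "B \<subseteq> index_set k lam" by auto
  with assms(3) show ?thesis
    unfolding Omega_def by (intro rat_funs_prod rat_funs_diff rat_funs_rvar) auto
qed

lemma translate_rconst: "translate a c (rconst d) = rconst d"
  by (simp add: rconst_def translate_Fract) (simp add: translate_poly_def)

lemma shift_op_in_End: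
  assumes "\<And>j. 1 \<le> j \<Longrightarrow> j \<le> n \<Longrightarrow> h j \<in> rat_funs A"
  shows "(\<lambda>f\<in>rat_funs A. \<Sum>j=1..n. h j * translate (b j) c f) \<in> carrier (End_ring (rat_funs A))"
  using assms
  by (intro End_ringI)
     (auto intro!: rat_funs_sum rat_funs_mult rat_funs_add translate_rat_funs
       simp: translate_add translate_mult translate_rconst sum_distrib_left sum.distrib algebra_simps)

lemma E_op_in_End:
  assumes "i \<in> {1..<k}"
  shows "E_op k lam i \<in> carrier (End_ring (Omega k lam))"
  unfolding E_op_def phi_def Omega_def
proof (rule shift_op_in_End, fold Omega_def)
  fix j assume "1 \<le> j" "j \<le> lam i"
  with assms have "(i, j) \<in> index_set k lam" by (auto simp: index_set_def)
  with assms show "(\<Prod>a\<in>row lam (i + 1). rvar (i, j) - rvar a) /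
      (\<Prod>b\<in>row lam i - {(i, j)}. rvar (i, j) - rvar b) \<in> Omega k lam"
    by (subst Omega_def, intro rat_funs_divide, fold Omega_def)
       (auto intro: row_prod_in_Omega[of "i + 1"] row_prod_in_Omega[of i])
qed

lemma F_op_in_End:
  assumes "i \<in> {1..<k}"
  shows "F_op k lam i \<in> carrier (End_ring (Omega k lam))"
  unfolding F_op_def inv_phi Omega_def
proof (rule shift_op_in_End, fold Omega_def)
  fix j assume "1 \<le> j" "j \<le> lam i"
  with assms have "(i, j) \<in> index_set k lam" by (auto simp: index_set_def)
  with assms show "(\<Prod>a\<in>row lam (i - 1). rvar (i, j) - rvar a) /
      (\<Prod>b\<in>row lam i - {(i, j)}. rvar (i, j) - rvar b) \<in> Omega k lam"
    by (subst Omega_def, intro rat_funs_divide, fold Omega_def)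
       (auto intro: row_prod_in_Omega[of "i - 1"] row_prod_in_Omega[of i])
qed

lemma gamma_op_in_End:
  assumes "a \<in> index_set k lam"
  shows "gamma_op k lam a \<in> carrier (End_ring (Omega k lam))"
proof -
  obtain i j where a: "a = (i, j)" by (cases a)
  with assms have "row lam i \<subseteq> index_set k lam" by (intro row_subset) (auto simp: index_set_def)
  then have "elem_sym j (row lam i) \<in> rat_funs (index_set k lam)"
    unfolding elem_sym_def by (intro rat_funs_sum rat_funs_prod rat_funs_rvar) auto
  then show ?thesis by (simp add: a gamma_op_def Omega_def mult_op_in_End)
qed

lemma ring_OGZ: "ring (OGZ k lam)"
  unfolding OGZ_def Omega_def
  by (rule ring_subalgebra_gen, fold Omega_def)
     (use E_op_in_End F_op_in_End gamma_op_in_End in blast)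

lemma ring_GZ_sub: "ring (GZ_sub k lam)"
  unfolding GZ_sub_def Omega_def
  by (rule ring_subalgebra_gen, fold Omega_def) (use gamma_op_in_End in blast)

lemma GZ_sub_subset_OGZ: "carrier (GZ_sub k lam) \<subseteq> carrier (OGZ k lam)"
proof
  fix T assume "T \<in> carrier (GZ_sub k lam)"
  then have "T \<in> generate_ring (End_ring (Omega k lam))
      (range (scalar_op (Omega k lam)) \<union> gamma_op k lam ` index_set k lam)"
    by (simp add: GZ_sub_def subalgebra_gen_def)
  then show "T \<in> carrier (OGZ k lam)"
    unfolding OGZ_def subalgebra_gen_def
    by induction (auto intro: generate_ring.intros)
qed

definition is_character :: "nat \<Rightarrow> (nat \<Rightarrow> nat) \<Rightarrow> ((rfun \<Rightarrow> rfun) \<Rightarrow> complex) \<Rightarrow> bool" where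
  "is_character k lam \<chi> \<longleftrightarrow>
     \<chi> \<in> ring_hom (GZ_sub k lam) (ring_of_type_algebra :: complex ring) \<and>
     (\<forall>c. \<forall>g\<in>carrier (GZ_sub k lam).
        \<chi> (scalar_op (Omega k lam) c \<otimes>\<^bsub>GZ_sub k lam\<^esub> g) = c * \<chi> g)"


section \<open>Right modules over a not necessarily commutative ring\<close>

text \<open>
  The library's \<^locale>\<open>module\<close> covers only commutative rings. As there, only the additive part of
  the record \<open>M\<close> is used. A right module over an algebra of linear transformations is a complex
  vector space through the operators \<^const>\<open>scalar_op\<close>.
\<close>

locale right_module = R: ring R + M: abelian_group M
  for R :: "('r, 'x) ring_scheme" and M :: "('m, 'y) ring_scheme"
  and act :: "'m \<Rightarrow> 'r \<Rightarrow> 'm" +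
  assumes act_closed: "x \<in> carrier M \<Longrightarrow> r \<in> carrier R \<Longrightarrow> act x r \<in> carrier M"
    and act_add_left: "x \<in> carrier M \<Longrightarrow> y \<in> carrier M \<Longrightarrow> r \<in> carrier R \<Longrightarrow>
      act (x \<oplus>\<^bsub>M\<^esub> y) r = act x r \<oplus>\<^bsub>M\<^esub> act y r"
    and act_add_right: "x \<in> carrier M \<Longrightarrow> r \<in> carrier R \<Longrightarrow> s \<in> carrier R \<Longrightarrow>
      act x (r \<oplus>\<^bsub>R\<^esub> s) = act x r \<oplus>\<^bsub>M\<^esub> act x s"
    and act_mult: "x \<in> carrier M \<Longrightarrow> r \<in> carrier R \<Longrightarrow> s \<in> carrier R \<Longrightarrow>
      act x (r \<otimes>\<^bsub>R\<^esub> s) = act (act x r) s"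
    and act_one: "x \<in> carrier M \<Longrightarrow> act x \<one>\<^bsub>R\<^esub> = x"

text \<open>
  Existence of a module is asserted with elements in the following type. This loses nothing: an
  algebra generated by finitely many transformations over the complex numbers has the cardinality
  of the continuum, hence so has every non-zero cyclic right module, and the type is larger.
\<close>

type_synonym mod_elem = "rfun \<Rightarrow> complex"

end

theory Submission
  imports Defs
begin

text \<open>
  The idea is to find the module inside the dual of a natural left module. The algebra
  \<open>\<Gamma>\<^sub>\<lambda>\<close> consists of multiplications by the elements of a ring \<open>L \<subseteq> \<Omega>\<close> (\<open>GZ_funs\<close> below), and \<open>L\<close>
  is stable under all of \<open>U\<^sub>\<lambda>\<close> (lemma \<open>OGZ_preserves_GZ_funs\<close>), although the coefficients of
  \<open>E\<^sub>i\<close> and \<open>F\<^sub>i\<close> have denominators. Hence the dual space of \<open>L\<close> is a right \<open>U\<^sub>\<lambda>\<close>-module by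
  \<open>(m \<cdot> u)(f) = m (u f)\<close>. Under the identification of \<open>\<Gamma>\<^sub>\<lambda>\<close> with \<open>L\<close> a character \<open>\<chi>\<close>
  is itself an element of this dual, it is non-zero since \<open>\<chi> 1 = 1\<close>, and multiplicativity of
  \<open>\<chi>\<close> says precisely that \<open>\<chi> \<cdot> \<gamma> = \<chi>(\<gamma>) \<chi>\<close>.

  Stability of \<open>L\<close> is where the form of \<open>E\<^sub>i\<close> and \<open>F\<^sub>i\<close> enters. Write \<open>x\<^sub>1, \<dots>, x\<^sub>n\<close> for the
  variables of row \<open>i\<close>. For \<open>f \<in> L\<close> there is one polynomial \<open>q\<close> with coefficients in \<open>L\<close> such
  that the shift of \<open>f\<close> in the variable \<open>x\<^sub>j\<close> is \<open>q(x\<^sub>j)\<close> for every \<open>j\<close>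
  (lemma \<open>translate_eq_poly\<close>), because the elementary symmetric polynomials of the variables other
  than \<open>x\<^sub>j\<close> are polynomials in \<open>x\<^sub>j\<close> with coefficients in \<open>L\<close>. The numerators of \<open>E\<^sub>i\<close> and
  \<open>F\<^sub>i\<close> are of this form as well. So everything reduces to sums
  \<open>\<Sum>\<^sub>j q(x\<^sub>j) / \<Prod>\<^sub>b\<^sub>\<noteq>\<^sub>j (x\<^sub>j - x\<^sub>b)\<close>, and these lie in \<open>L\<close>
  (lemma \<open>sum_over_roots_in\<close>): for \<open>q = t\<^sup>d\<close> with \<open>d < n\<close> Lagrange interpolation gives \<open>0\<close> or
  \<open>1\<close>, and larger \<open>d\<close> are reduced to smaller ones by the relation \<open>w(x\<^sub>j) = 0\<close> for
  \<open>w = \<Prod>\<^sub>b (t - x\<^sub>b)\<close>, whose coefficients are in \<open>L\<close>.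
\<close>

section \<open>Symmetric sums over the roots of a polynomial\<close>

lemma
  fixes x :: "'i \<Rightarrow> 'a::idom"
  shows degree_prod_roots: "degree (\<Prod>b\<in>B. [:- x b, 1:]) = card B"
    and coeff_prod_roots_card: "coeff (\<Prod>b\<in>B. [:- x b, 1:]) (card B) = 1"
proof -
  show deg: "degree (\<Prod>b\<in>B. [:- x b, 1:]) = card B"
    by (subst degree_prod_sum_eq) auto
  show "coeff (\<Prod>b\<in>B. [:- x b, 1:]) (card B) = 1"
    using lead_coeff_prod[of "\<lambda>b. [:- x b, 1:]" B] by (simp add: deg)
qed

text \<open>
  The sum is the coefficient of \<open>t\<^sup>n\<^sup>-\<^sup>1\<close> in the polynomial of degree less than \<open>n\<close> that
  interpolates \<open>t\<^sup>d\<close> at the \<open>n\<close> points \<open>x j\<close>, that is, in \<open>t\<^sup>d\<close> itself.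
\<close>

lemma lagrange_power_sum:
  fixes x :: "'i \<Rightarrow> 'a::field"
  assumes "finite J" "inj_on x J" "d < card J"
  shows "(\<Sum>j\<in>J. x j ^ d / (\<Prod>b\<in>J - {j}. x j - x b)) = (if Suc d = card J then 1 else 0)"
proof -
  define D where "D j = (\<Prod>b\<in>J - {j}. x j - x b)" for j
  define p where "p = (\<Sum>j\<in>J. smult (x j ^ d / D j) (\<Prod>b\<in>J - {j}. [:- x b, 1:]))"
  have D: "D j \<noteq> 0" if "j \<in> J" for j
    using assms that by (auto simp: D_def inj_on_def)
  have degp: "degree p < card J"
    unfolding p_def using assms(3)
  proof (intro degree_sum_less)
    fix j assume "j \<in> J"
    then have "degree (\<Prod>b\<in>J - {j}. [:- x b, 1:]) < card J"
      using assms(1) by (subst degree_prod_roots) (rule card_Diff1_less)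
    then show "degree (smult (x j ^ d / D j) (\<Prod>b\<in>J - {j}. [:- x b, 1:])) < card J"
      using degree_smult_le le_less_trans by blast
  qed simp
  have "poly (p - monom 1 d) (x i) = 0" if i: "i \<in> J" for i
  proof -
    have "(\<Prod>b\<in>J - {j}. x i - x b) = 0" if "j \<noteq> i" for j
      using assms(1) i that by (intro prod_zero) auto
    then have "poly p (x i) = (\<Sum>j\<in>J. if j = i then x j ^ d else 0)"
      unfolding p_def poly_sum using D
      by (intro sum.cong) (auto simp: poly_prod D_def)
    then show ?thesis using i assms(1) by (simp add: poly_monom)
  qed
  then have "x ` J \<subseteq> {t. poly (p - monom 1 d) t = 0}" by auto
  moreover have "card (x ` J) = card J" using assms(2) by (rule card_image)
  moreover have "degree (p - monom 1 d) < card J"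
    using degp assms(3) degree_monom_le[of "1::'a" d] by (intro degree_diff_less) auto
  ultimately have "p - monom 1 d = 0"
    by (metis card_poly_roots_bound card_mono leD le_trans poly_roots_finite)
  then have "coeff p (card J - 1) = coeff (monom 1 d) (card J - 1)" by simp
  moreover have "coeff p (card J - 1) = (\<Sum>j\<in>J. x j ^ d / D j)"
    unfolding p_def coeff_sum
  proof (intro sum.cong refl)
    fix j assume "j \<in> J"
    then have "card (J - {j}) = card J - 1" by simp
    then show "coeff (smult (x j ^ d / D j) (\<Prod>b\<in>J - {j}. [:- x b, 1:])) (card J - 1) = x j ^ d / D j"
      using coeff_prod_roots_card[of x "J - {j}"] by simp
  qed
  moreover have "d = card J - 1 \<longleftrightarrow> Suc d = card J" using assms(3) by linarith
  ultimately show ?thesis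
    unfolding D_def by simp
qed

locale subring_set =
  fixes K :: "'a::field set"
  assumes one_in: "1 \<in> K"
    and diff_in: "f \<in> K \<Longrightarrow> g \<in> K \<Longrightarrow> f - g \<in> K"
    and mult_in: "f \<in> K \<Longrightarrow> g \<in> K \<Longrightarrow> f * g \<in> K"
begin

lemma zero_in: "0 \<in> K"
  using diff_in[OF one_in one_in] by simp

lemma uminus_in: "f \<in> K \<Longrightarrow> - f \<in> K"
  using diff_in[OF zero_in] by simp

lemma add_in: "f \<in> K \<Longrightarrow> g \<in> K \<Longrightarrow> f + g \<in> K"
  using diff_in[of f "- g"] uminus_in by simp

lemma sum_in: "(\<And>i. i \<in> B \<Longrightarrow> f i \<in> K) \<Longrightarrow> sum f B \<in> K"
  by (induction B rule: infinite_finite_induct) (auto intro: zero_in add_in)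

lemma power_in: "f \<in> K \<Longrightarrow> f ^ n \<in> K"
  by (induction n) (auto intro: one_in mult_in)

definition polys :: "'a poly set" where
  "polys = {q. \<forall>n. coeff q n \<in> K}"

lemma polysD: "q \<in> polys \<Longrightarrow> coeff q n \<in> K"
  by (simp add: polys_def)

lemma polys_const: "f \<in> K \<Longrightarrow> [:f:] \<in> polys"
  by (auto simp: polys_def coeff_pCons zero_in split: nat.split)

lemma polys_X: "[:0, 1:] \<in> polys"
  by (auto simp: polys_def coeff_pCons zero_in one_in split: nat.split)

lemma polys_add: "p \<in> polys \<Longrightarrow> q \<in> polys \<Longrightarrow> p + q \<in> polys"
  by (simp add: polys_def add_in)

lemma polys_diff: "p \<in> polys \<Longrightarrow> q \<in> polys \<Longrightarrow> p - q \<in> polys"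
  by (simp add: polys_def diff_in)

lemma polys_mult: "p \<in> polys \<Longrightarrow> q \<in> polys \<Longrightarrow> p * q \<in> polys"
  by (auto simp: polys_def coeff_mult intro!: sum_in mult_in)

text \<open>
  The value is a symmetric function of the roots: for \<open>q = t\<^sup>d\<close> it is the complete homogeneous
  symmetric polynomial of degree \<open>d - n + 1\<close> in the \<open>n\<close> roots. So it is no surprise
  that it is expressible by the coefficients of the monic polynomial with these roots. The
  recursion below is the one between elementary and complete homogeneous symmetric polynomials.
\<close>

lemma sum_over_roots_in:
  assumes J: "finite J" "inj_on x J"
    and w: "(\<Prod>b\<in>J. [:- x b, 1:]) \<in> polys"
    and q: "q \<in> polys"
  shows "(\<Sum>j\<in>J. poly q (x j) / (\<Prod>b\<in>J - {j}. x j - x b)) \<in> K"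
proof -
  let ?n = "card J" and ?w = "\<Prod>b\<in>J. [:- x b, 1:]"
  define D where "D j = (\<Prod>b\<in>J - {j}. x j - x b)" for j
  have power: "(\<Sum>j\<in>J. x j ^ d / D j) \<in> K" for d
  proof (induction d rule: less_induct)
    case (less d)
    show ?case
    proof (cases "d < ?n")
      case True
      then show ?thesis
        using lagrange_power_sum[OF J True] zero_in one_in by (simp add: D_def)
    next
      case False
      have "x j ^ d = - (\<Sum>s<?n. coeff ?w s * x j ^ (s + (d - ?n)))" if j: "j \<in> J" for j
      proof -
        have "poly ?w (x j) = 0"
          unfolding poly_prod using j J(1) by (intro prod_zero) auto
        then have "(\<Sum>s\<le>?n. coeff ?w s * x j ^ s) = 0"
          by (simp add: poly_altdef degree_prod_roots)
        then have "x j ^ ?n = - (\<Sum>s<?n. coeff ?w s * x j ^ s)"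
          by (simp add: lessThan_Suc_atMost[symmetric] coeff_prod_roots_card eq_neg_iff_add_eq_0
              add.commute)
        moreover have "x j ^ d = x j ^ ?n * x j ^ (d - ?n)"
          using False by (simp flip: power_add)
        ultimately show ?thesis
          by (simp add: sum_distrib_right power_add mult.assoc)
      qed
      then have "(\<Sum>j\<in>J. x j ^ d / D j)
          = (\<Sum>j\<in>J. - (\<Sum>s<?n. coeff ?w s * x j ^ (s + (d - ?n))) / D j)"
        by simp
      also have "\<dots> = - (\<Sum>s<?n. coeff ?w s * (\<Sum>j\<in>J. x j ^ (s + (d - ?n)) / D j))"
        by (subst sum_distrib_left, subst sum.swap)
           (simp add: sum_negf sum_divide_distrib)
      also have "\<dots> \<in> K"
        using False by (intro uminus_in sum_in mult_in less.IH polysD[OF w]) auto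
      finally show ?thesis .
    qed
  qed
  have "(\<Sum>j\<in>J. poly q (x j) / D j)
      = (\<Sum>s\<le>degree q. coeff q s * (\<Sum>j\<in>J. x j ^ s / D j))"
    by (subst sum_distrib_left, subst sum.swap)
       (simp add: poly_altdef sum_divide_distrib)
  also have "\<dots> \<in> K"
    by (rule sum_in) (rule mult_in[OF polysD[OF q] power])
  finally show ?thesis by (simp add: D_def)
qed

end

section \<open>Elementary symmetric polynomials\<close>

lemma elem_sym_0: "finite A \<Longrightarrow> elem_sym 0 A = 1"
proof -
  assume "finite A"
  then have "{S. S \<subseteq> A \<and> card S = 0} = {{}}" by (auto dest: finite_subset)
  then show ?thesis by (simp add: elem_sym_def)
qed

lemma elem_sym_eq_0: "finite A \<Longrightarrow> card A < r \<Longrightarrow> elem_sym r A = 0"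
proof -
  assume "finite A" "card A < r"
  then have "{S. S \<subseteq> A \<and> card S = r} = {}" using card_mono leD by blast
  then show ?thesis by (simp only: elem_sym_def sum.empty)
qed

lemma elem_sym_insert:
  assumes "finite A" "a \<notin> A"
  shows "elem_sym (Suc r) (insert a A) = elem_sym (Suc r) A + rvar a * elem_sym r A"
proof -
  let ?P = "{S. S \<subseteq> A \<and> card S = Suc r}" and ?Q = "{S. S \<subseteq> A \<and> card S = r}"
  have "{S. S \<subseteq> insert a A \<and> card S = Suc r} = ?P \<union> insert a ` ?Q"
  proof (intro Set.set_eqI iffI)
    fix S assume S: "S \<in> {S. S \<subseteq> insert a A \<and> card S = Suc r}"
    show "S \<in> ?P \<union> insert a ` ?Q"
    proof (cases "a \<in> S")
      case True
      then have "S = insert a (S - {a})" "S - {a} \<in> ?Q"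
        using S by auto
      then show ?thesis by blast
    qed (use S in auto)
  next
    fix S assume "S \<in> ?P \<union> insert a ` ?Q"
    then show "S \<in> {S. S \<subseteq> insert a A \<and> card S = Suc r}"
    proof
      assume "S \<in> insert a ` ?Q"
      then obtain T where T: "S = insert a T" "T \<subseteq> A" "card T = r" by auto
      then have "finite T" "a \<notin> T" using assms finite_subset by auto
      with T show ?thesis by auto
    qed auto
  qed
  moreover have "?P \<inter> insert a ` ?Q = {}" using assms(2) by auto
  moreover have "finite ?P" "finite (insert a ` ?Q)" using assms(1) by auto
  ultimately have "elem_sym (Suc r) (insert a A)
      = elem_sym (Suc r) A + (\<Sum>S\<in>insert a ` ?Q. \<Prod>b\<in>S. rvar b)"
    unfolding elem_sym_def by (simp add: sum.union_disjoint)
  also have "(\<Sum>S\<in>insert a ` ?Q. \<Prod>b\<in>S. rvar b) = (\<Sum>S\<in>?Q. \<Prod>b\<in>insert a S. rvar b)"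
    using assms(2) by (intro sum.reindex_cong[of "insert a"]) (auto simp: inj_on_def)
  also have "\<dots> = rvar a * elem_sym r A"
    unfolding elem_sym_def sum_distrib_left
  proof (intro sum.cong refl)
    fix S assume "S \<in> ?Q"
    then have "finite S" "a \<notin> S" using assms finite_subset by auto
    then show "(\<Prod>b\<in>insert a S. rvar b) = rvar a * (\<Prod>b\<in>S. rvar b)" by simp
  qed
  finally show ?thesis .
qed

lemma elem_sym_remove:
  assumes "finite A" "a \<in> A"
  shows "elem_sym (Suc r) (A - {a}) = elem_sym (Suc r) A - rvar a * elem_sym r (A - {a})"
  using elem_sym_insert[of "A - {a}" a r] assms by (simp add: insert_absorb)

lemma coeff_prod_roots_elem_sym:
  assumes "finite A" "r \<le> card A"
  shows "coeff (\<Prod>b\<in>A. [:- rvar b, 1:]) (card A - r) = (- 1) ^ r * elem_sym r A"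
  using assms
proof (induction A arbitrary: r rule: finite_induct)
  case empty
  then show ?case by (simp add: elem_sym_0)
next
  case (insert a A)
  show ?case
  proof (cases r)
    case 0
    then show ?thesis
      using insert.hyps coeff_prod_roots_card[of rvar "insert a A"] by (simp add: elem_sym_0)
  next
    case (Suc s)
    with insert.prems insert.hyps have s: "s \<le> card A" by simp
    let ?w = "\<Prod>b\<in>A. [:- rvar b, 1:]"
    have "coeff (\<Prod>b\<in>insert a A. [:- rvar b, 1:]) (card (insert a A) - r)
        = coeff (smult (- rvar a) ?w + pCons 0 ?w) (card A - s)"
      using insert.hyps Suc by simp
    also have "\<dots> = - rvar a * ((- 1) ^ s * elem_sym s A) + coeff (pCons 0 ?w) (card A - s)"
      using insert.IH[OF s] by simp
    also have "coeff (pCons 0 ?w) (card A - s) = (- 1) ^ Suc s * elem_sym (Suc s) A"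
    proof (cases "s = card A")
      case True
      then show ?thesis using insert.hyps by (simp add: elem_sym_eq_0)
    next
      case False
      with s have "Suc s \<le> card A" "card A - s = Suc (card A - Suc s)" by auto
      then show ?thesis using insert.IH[of "Suc s"] by simp
    qed
    also have "- rvar a * ((- 1) ^ s * elem_sym s A) + (- 1) ^ Suc s * elem_sym (Suc s) A
        = (- 1) ^ r * elem_sym r (insert a A)"
      using insert.hyps by (simp add: Suc elem_sym_insert algebra_simps)
    finally show ?thesis .
  qed
qed

lemma translate_rvar: "translate a c (rvar b) = rvar b + (if a = b then rconst c else 0)"
  by (simp add: rvar_def rconst_def translate_Fract)
     (simp add: translate_poly_def)

lemma translate_0: "translate a c 0 = 0"
  using translate_rconst[of a c 0] by simp

lemma translate_1: "translate a c 1 = 1"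
  using translate_rconst[of a c 1] by simp

lemma translate_sum: "translate a c (sum f A) = (\<Sum>i\<in>A. translate a c (f i))"
  by (induction A rule: infinite_finite_induct) (auto simp: translate_add translate_0)

lemma translate_prod: "translate a c (prod f A) = (\<Prod>i\<in>A. translate a c (f i))"
  by (induction A rule: infinite_finite_induct) (auto simp: translate_mult translate_1)

lemma translate_elem_sym_notin:
  assumes "a \<notin> A"
  shows "translate a c (elem_sym r A) = elem_sym r A"
proof -
  have "translate a c (rvar b) = rvar b" if "b \<in> S" "S \<subseteq> A" for b S
    using assms that by (auto simp: translate_rvar)
  then show ?thesis
    by (simp add: elem_sym_def translate_sum translate_prod)
qed

lemma translate_elem_sym_in:
  assumes "finite A" "a \<in> A"
  shows "translate a c (elem_sym (Suc r) A) = elem_sym (Suc r) A + rconst c * elem_sym r (A - {a})"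
proof -
  have e: "elem_sym (Suc r) A = elem_sym (Suc r) (A - {a}) + rvar a * elem_sym r (A - {a})"
    using elem_sym_remove[OF assms, of r] by simp
  show ?thesis
    unfolding e
    by (simp add: translate_add translate_mult translate_elem_sym_notin translate_rvar algebra_simps)
qed

lemma inj_rvar: "inj rvar"
proof (rule injI)
  fix a b assume "rvar a = rvar b"
  then have "pvar a = pvar b" by (simp add: rvar_def eq_fract)
  then have "pvars (pvar a) = pvars (pvar b)" by simp
  then show "a = b" by simp
qed

section \<open>The Gelfand-Zeitlin subalgebra as a ring of rational functions\<close>

lemma finite_row: "finite (row lam i)"
proof -
  have "row lam i \<subseteq> Pair i ` {1..lam i}" by (auto simp: row_def)
  then show ?thesis by (rule finite_subset) simp
qed

lemma card_row_le: "card (row lam i) \<le> lam i"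
proof -
  have "row lam i \<subseteq> Pair i ` {1..lam i}" by (auto simp: row_def)
  then have "card (row lam i) \<le> card (Pair i ` {1..lam i})" by (intro card_mono) auto
  also have "\<dots> \<le> lam i" using card_image_le[of "{1..lam i}" "Pair i"] by simp
  finally show ?thesis .
qed

lemma sum_row:
  assumes "1 \<le> i"
  shows "(\<Sum>j=1..lam i. h (i, j)) = (\<Sum>a\<in>row lam i. h a)"
proof -
  have "row lam i = Pair i ` {1..lam i}" using assms by (auto simp: row_def)
  then show ?thesis by (simp add: sum.reindex inj_on_def)
qed

inductive_set GZ_funs :: "nat \<Rightarrow> (nat \<Rightarrow> nat) \<Rightarrow> rfun set" for k lam where
  const: "rconst c \<in> GZ_funs k lam"
| gen: "(i, j) \<in> index_set k lam \<Longrightarrow> elem_sym j (row lam i) \<in> GZ_funs k lam"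
| add: "f \<in> GZ_funs k lam \<Longrightarrow> g \<in> GZ_funs k lam \<Longrightarrow> f + g \<in> GZ_funs k lam"
| mult: "f \<in> GZ_funs k lam \<Longrightarrow> g \<in> GZ_funs k lam \<Longrightarrow> f * g \<in> GZ_funs k lam"

lemma rconst_minus_1: "rconst (- 1) = - 1"
proof -
  have "rconst (- 1) + 1 = rconst (- 1 + 1)"
    unfolding rconst_def pconst_add by (simp add: One_fract_def)
  then show ?thesis by (simp add: eq_neg_iff_add_eq_0)
qed

lemma GZ_funs_uminus: "f \<in> GZ_funs k lam \<Longrightarrow> - f \<in> GZ_funs k lam"
  using GZ_funs.mult[OF GZ_funs.const[of "- 1"]] by (simp add: rconst_minus_1)

lemma GZ_funs_1: "1 \<in> GZ_funs k lam"
  using GZ_funs.const[of 1] by simp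

interpretation GZ: subring_set "GZ_funs k lam" for k lam
proof
  fix f g assume "f \<in> GZ_funs k lam" "g \<in> GZ_funs k lam"
  then show "f - g \<in> GZ_funs k lam"
    using GZ_funs.add[OF _ GZ_funs_uminus, of f k lam g] by simp
qed (auto intro: GZ_funs_1 GZ_funs.mult)

lemma GZ_funs_Omega: "f \<in> GZ_funs k lam \<Longrightarrow> f \<in> Omega k lam"
proof (induction rule: GZ_funs.induct)
  case (gen i j)
  then have "row lam i \<subseteq> index_set k lam" by (intro row_subset) (auto simp: index_set_def)
  then show ?case
    unfolding elem_sym_def Omega_def by (intro rat_funs_sum rat_funs_prod rat_funs_rvar) auto
qed (auto simp: Omega_def rat_funs_add rat_funs_mult)

lemma mult_op_mult:
  "g \<in> Omega k lam \<Longrightarrow>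
    mult_op (Omega k lam) f \<otimes>\<^bsub>End_ring (Omega k lam)\<^esub> mult_op (Omega k lam) g
      = mult_op (Omega k lam) (f * g)"
  by (auto simp: End_ring_simps compose_def mult_op_def Omega_def rat_funs_mult)

lemma mult_op_add:
  "mult_op (Omega k lam) f \<oplus>\<^bsub>End_ring (Omega k lam)\<^esub> mult_op (Omega k lam) g
    = mult_op (Omega k lam) (f + g)"
  by (auto simp: End_ring_simps mult_op_def algebra_simps)

lemma ring_End_Omega: "ring (End_ring (Omega k lam))"
  unfolding Omega_def by (rule ring_End_ring)

lemma End_Omega_minus:
  assumes "T \<in> carrier (End_ring (Omega k lam))" "f \<in> Omega k lam"
  shows "(\<ominus>\<^bsub>End_ring (Omega k lam)\<^esub> T) f = - T f"
proof -
  interpret ring "End_ring (Omega k lam)" by (rule ring_End_Omega)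
  have "(\<ominus>\<^bsub>End_ring (Omega k lam)\<^esub> T \<oplus>\<^bsub>End_ring (Omega k lam)\<^esub> T) f
      = \<zero>\<^bsub>End_ring (Omega k lam)\<^esub> f"
    using assms(1) by (simp add: l_neg)
  then show ?thesis
    using assms(2) by (simp add: End_ring_simps eq_neg_iff_add_eq_0)
qed

lemma mult_op_minus:
  assumes "f \<in> Omega k lam"
  shows "\<ominus>\<^bsub>End_ring (Omega k lam)\<^esub> mult_op (Omega k lam) f = mult_op (Omega k lam) (- f)"
proof -
  interpret ring "End_ring (Omega k lam)" by (rule ring_End_Omega)
  have car: "mult_op (Omega k lam) g \<in> carrier (End_ring (Omega k lam))" if "g \<in> Omega k lam" for g
    using that unfolding Omega_def by (rule mult_op_in_End)
  have "mult_op (Omega k lam) (- f) \<oplus>\<^bsub>End_ring (Omega k lam)\<^esub> mult_op (Omega k lam) f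
      = \<zero>\<^bsub>End_ring (Omega k lam)\<^esub>"
    unfolding mult_op_add by (simp add: mult_op_def End_ring_simps)
  moreover have "- f \<in> Omega k lam" using assms by (simp add: Omega_def rat_funs_uminus)
  ultimately show ?thesis using assms by (intro minus_equality car)
qed

lemma carrier_GZ_sub: "carrier (GZ_sub k lam) = mult_op (Omega k lam) ` GZ_funs k lam"
proof
  let ?E = "End_ring (Omega k lam)"
  let ?G = "range (scalar_op (Omega k lam)) \<union> gamma_op k lam ` index_set k lam"
  have car: "carrier (GZ_sub k lam) = generate_ring ?E ?G"
    by (simp add: GZ_sub_def subalgebra_gen_def)
  show "carrier (GZ_sub k lam) \<subseteq> mult_op (Omega k lam) ` GZ_funs k lam"
  proof
    fix T assume "T \<in> carrier (GZ_sub k lam)"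
    then have "T \<in> generate_ring ?E ?G" by (simp add: car)
    then show "T \<in> mult_op (Omega k lam) ` GZ_funs k lam"
    proof induction
      case one
      have "\<one>\<^bsub>?E\<^esub> = mult_op (Omega k lam) 1" by (simp add: End_ring_simps mult_op_def)
      then show ?case using GZ_funs_1 by blast
    next
      case (incl h)
      then show ?case
        by (auto simp: scalar_op_def gamma_op_def intro: GZ_funs.const GZ_funs.gen)
    next
      case (a_inv h)
      then show ?case by (auto simp: mult_op_minus GZ_funs_Omega intro: GZ_funs_uminus)
    next
      case (eng_add g h)
      then show ?case by (auto simp: mult_op_add intro: GZ_funs.add)
    next
      case (eng_mult g h)
      then show ?case by (auto simp: mult_op_mult GZ_funs_Omega intro: GZ_funs.mult)
    qed
  qed
  have "mult_op (Omega k lam) f \<in> generate_ring ?E ?G" if "f \<in> GZ_funs k lam" for f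
    using that
  proof induction
    case (const c)
    show ?case by (rule generate_ring.incl) (simp add: scalar_op_def)
  next
    case (gen i j)
    then have "gamma_op k lam (i, j) \<in> generate_ring ?E ?G" by (intro generate_ring.incl) blast
    then show ?case by (simp add: gamma_op_def)
  next
    case (add f g)
    then show ?case using generate_ring.eng_add by (fastforce simp flip: mult_op_add)
  next
    case (mult f g)
    then show ?case
      using generate_ring.eng_mult[OF mult.IH] by (simp add: mult_op_mult GZ_funs_Omega)
  qed
  then show "mult_op (Omega k lam) ` GZ_funs k lam \<subseteq> carrier (GZ_sub k lam)"
    by (auto simp: car)
qed

lemma elem_sym_row_in:
  assumes "1 \<le> i" "i \<le> k"
  shows "elem_sym r (row lam i) \<in> GZ_funs k lam"
proof -
  consider "r = 0" | "card (row lam i) < r" | "1 \<le> r" "r \<le> lam i"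
    using card_row_le[of lam i] by linarith
  then show ?thesis
  proof cases
    case 3
    with assms show ?thesis by (intro GZ_funs.gen) (auto simp: index_set_def)
  qed (simp_all add: elem_sym_0 elem_sym_eq_0 finite_row GZ_funs_1 GZ.zero_in)
qed

lemma row_poly_in:
  assumes "i \<le> k"
  shows "(\<Prod>b\<in>row lam i. [:- rvar b, 1:]) \<in> GZ.polys k lam"
proof (cases "i = 0")
  case True
  then show ?thesis using GZ.polys_const[OF GZ_funs_1] by (simp add: row_def one_pCons)
next
  case False
  let ?w = "\<Prod>b\<in>row lam i. [:- rvar b, 1:]" and ?n = "card (row lam i)"
  have "coeff ?w s \<in> GZ_funs k lam" for s
  proof (cases "s \<le> ?n")
    case True
    then have "coeff ?w s = (- 1) ^ (?n - s) * elem_sym (?n - s) (row lam i)"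
      using coeff_prod_roots_elem_sym[OF finite_row, of "?n - s" lam i] by simp
    with False assms show ?thesis
      by (simp add: elem_sym_row_in GZ.mult_in GZ.power_in GZ.uminus_in GZ_funs_1)
  next
    case False
    then have "coeff ?w s = 0" by (intro coeff_eq_0) (simp add: degree_prod_roots)
    then show ?thesis by (simp add: GZ.zero_in)
  qed
  then show ?thesis by (simp add: GZ.polys_def)
qed

section \<open>Stability of the ring under the algebra\<close>

text \<open>
  The recursion \<open>e\<^sub>r\<^sub>+\<^sub>1(A - {a}) = e\<^sub>r\<^sub>+\<^sub>1(A) - x\<^sub>a e\<^sub>r(A - {a})\<close> involves \<open>a\<close> only
  through \<open>x\<^sub>a\<close>, so it produces the same polynomial for all \<open>a\<close> in the row.
\<close>

lemma elem_sym_remove_eq_poly: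
  assumes "1 \<le> i" "i \<le> k"
  shows "\<exists>q\<in>GZ.polys k lam. \<forall>a\<in>row lam i. elem_sym r (row lam i - {a}) = poly q (rvar a)"
proof (induction r)
  case 0
  show ?case
    using GZ.polys_const[OF GZ_funs_1]
    by (intro bexI[of _ "[:1:]"]) (simp_all add: elem_sym_0 finite_row)
next
  case (Suc r)
  then obtain q where q: "q \<in> GZ.polys k lam"
    "\<And>a. a \<in> row lam i \<Longrightarrow> elem_sym r (row lam i - {a}) = poly q (rvar a)" by blast
  let ?p = "[:elem_sym (Suc r) (row lam i):] - [:0, 1:] * q"
  show ?case
  proof (rule bexI[of _ ?p])
    show "?p \<in> GZ.polys k lam"
      using assms q(1)
      by (intro GZ.polys_diff GZ.polys_mult GZ.polys_const GZ.polys_X elem_sym_row_in)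
    show "\<forall>a\<in>row lam i. elem_sym (Suc r) (row lam i - {a}) = poly ?p (rvar a)"
      using q(2) by (simp add: elem_sym_remove finite_row)
  qed
qed

text \<open>
  That a single \<open>q\<close> serves all variables of the row is what turns \<open>E\<^sub>i f\<close> and \<open>F\<^sub>i f\<close> into
  sums over the roots of the row polynomial.
\<close>

lemma translate_eq_poly:
  assumes i: "1 \<le> i" "i \<le> k" and f: "f \<in> GZ_funs k lam"
  shows "\<exists>q\<in>GZ.polys k lam. \<forall>a\<in>row lam i. translate a c f = poly q (rvar a)"
  using f
proof induction
  case (const d)
  show ?case
    using GZ.polys_const[OF GZ_funs.const[of d]]
    by (intro bexI[of _ "[:rconst d:]"]) (simp_all add: translate_rconst)
next
  case (gen l j)
  then have in_L: "elem_sym j (row lam l) \<in> GZ_funs k lam" by (rule GZ_funs.gen)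
  show ?case
  proof (cases "l = i")
    case False
    then have "a \<notin> row lam l" if "a \<in> row lam i" for a
      using that by (auto simp: row_def split: if_splits)
    then show ?thesis
      using GZ.polys_const[OF in_L]
      by (intro bexI[of _ "[:elem_sym j (row lam l):]"]) (simp_all add: translate_elem_sym_notin)
  next
    case True
    from gen obtain r where r: "j = Suc r" by (cases j) (auto simp: index_set_def)
    obtain q where q: "q \<in> GZ.polys k lam"
      "\<And>a. a \<in> row lam i \<Longrightarrow> elem_sym r (row lam i - {a}) = poly q (rvar a)"
      using elem_sym_remove_eq_poly[OF i] by blast
    let ?p = "[:elem_sym j (row lam l):] + [:rconst c:] * q"
    have "?p \<in> GZ.polys k lam"
      using q(1) in_L by (intro GZ.polys_add GZ.polys_mult GZ.polys_const GZ_funs.const)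
    moreover have "\<forall>a\<in>row lam i. translate a c (elem_sym j (row lam l)) = poly ?p (rvar a)"
      using q(2) by (simp add: True r translate_elem_sym_in finite_row)
    ultimately show ?thesis by blast
  qed
next
  case (add f g)
  then obtain p q where "p \<in> GZ.polys k lam" "q \<in> GZ.polys k lam"
    "\<forall>a\<in>row lam i. translate a c f = poly p (rvar a)"
    "\<forall>a\<in>row lam i. translate a c g = poly q (rvar a)" by blast
  then show ?case
    by (intro bexI[of _ "p + q"]) (auto simp: translate_add GZ.polys_add)
next
  case (mult f g)
  then obtain p q where "p \<in> GZ.polys k lam" "q \<in> GZ.polys k lam"
    "\<forall>a\<in>row lam i. translate a c f = poly p (rvar a)"
    "\<forall>a\<in>row lam i. translate a c g = poly q (rvar a)" by blast
  then show ?case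
    by (intro bexI[of _ "p * q"]) (auto simp: translate_mult GZ.polys_mult)
qed

text \<open>
  The common form of \<open>E\<^sub>i\<close> (with \<open>c = 1\<close>, \<open>l = i + 1\<close>) and \<open>F\<^sub>i\<close> (with \<open>c = -1\<close>,
  \<open>l = i - 1\<close>).
\<close>

lemma shift_sum_in_GZ_funs:
  assumes i: "1 \<le> i" "i \<le> k" and l: "l \<le> k" and f: "f \<in> GZ_funs k lam"
  shows "(\<Sum>j=1..lam i. (\<Prod>b\<in>row lam l. rvar (i, j) - rvar b) /
     (\<Prod>b\<in>row lam i - {(i, j)}. rvar (i, j) - rvar b) * translate (i, j) c f) \<in> GZ_funs k lam"
proof -
  obtain q where q: "q \<in> GZ.polys k lam"
    "\<And>a. a \<in> row lam i \<Longrightarrow> translate a c f = poly q (rvar a)"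
    using translate_eq_poly[OF i f] by blast
  let ?w = "\<Prod>b\<in>row lam l. [:- rvar b, 1:]"
  have "(\<Sum>a\<in>row lam i. poly (?w * q) (rvar a) / (\<Prod>b\<in>row lam i - {a}. rvar a - rvar b))
      \<in> GZ_funs k lam"
    using inj_rvar q(1) i(2) l
    by (intro GZ.sum_over_roots_in GZ.polys_mult row_poly_in finite_row) (auto intro: inj_on_subset)
  also have "(\<Sum>a\<in>row lam i. poly (?w * q) (rvar a) / (\<Prod>b\<in>row lam i - {a}. rvar a - rvar b))
      = (\<Sum>a\<in>row lam i. (\<Prod>b\<in>row lam l. rvar a - rvar b) /
          (\<Prod>b\<in>row lam i - {a}. rvar a - rvar b) * translate a c f)"
    by (intro sum.cong) (simp_all add: q(2) poly_prod)
  finally show ?thesis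
    using sum_row[OF i(1), where lam = lam and h = "\<lambda>a. (\<Prod>b\<in>row lam l. rvar a - rvar b) /
          (\<Prod>b\<in>row lam i - {a}. rvar a - rvar b) * translate a c f"] by simp
qed

lemma OGZ_in_End: "T \<in> carrier (OGZ k lam) \<Longrightarrow> T \<in> carrier (End_ring (Omega k lam))"
proof -
  assume "T \<in> carrier (OGZ k lam)"
  then have T: "T \<in> generate_ring (End_ring (Omega k lam)) (range (scalar_op (Omega k lam)) \<union>
      (E_op k lam ` {1..<k} \<union> F_op k lam ` {1..<k} \<union> gamma_op k lam ` index_set k lam))"
    by (simp add: OGZ_def subalgebra_gen_def)
  have "range (scalar_op (Omega k lam)) \<union>
      (E_op k lam ` {1..<k} \<union> F_op k lam ` {1..<k} \<union> gamma_op k lam ` index_set k lam)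
      \<subseteq> carrier (End_ring (Omega k lam))"
    using E_op_in_End F_op_in_End gamma_op_in_End scalar_op_in_End[of "index_set k lam"]
    by (fold Omega_def) blast
  from ring.generate_ring_in_carrier[OF ring_End_Omega this T] show ?thesis .
qed

lemma OGZ_preserves_GZ_funs:
  assumes "T \<in> carrier (OGZ k lam)" and f: "f \<in> GZ_funs k lam"
  shows "T f \<in> GZ_funs k lam"
proof -
  have "T \<in> generate_ring (End_ring (Omega k lam)) (range (scalar_op (Omega k lam)) \<union>
      (E_op k lam ` {1..<k} \<union> F_op k lam ` {1..<k} \<union> gamma_op k lam ` index_set k lam))"
    using assms(1) by (simp add: OGZ_def subalgebra_gen_def)
  then show ?thesis using f
  proof (induction arbitrary: f)
    case (incl h)
    note O = GZ_funs_Omega[OF incl.prems]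
    from incl.hyps consider c where "h = scalar_op (Omega k lam) c"
      | i where "i \<in> {1..<k}" "h = E_op k lam i"
      | i where "i \<in> {1..<k}" "h = F_op k lam i"
      | i j where "(i, j) \<in> index_set k lam" "h = gamma_op k lam (i, j)"
      by auto
    then show ?case
    proof cases
      case 1
      then show ?thesis
        using O incl.prems by (auto simp: scalar_op_def mult_op_def intro: GZ_funs.intros)
    next
      case 2
      then show ?thesis
        using O shift_sum_in_GZ_funs[of i k "i + 1" f lam 1] incl.prems
        by (simp add: E_op_def phi_def)
    next
      case 3
      then show ?thesis
        using O shift_sum_in_GZ_funs[of i k "i - 1" f lam "- 1"] incl.prems less_imp_diff_less[of i k 1]
        by (simp add: F_op_def inv_phi)
    next
      case 4
      then show ?thesis
        using O incl.prems by (auto simp: gamma_op_def mult_op_def intro: GZ_funs.intros)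
    qed
  next
    case (a_inv h)
    then have "h \<in> carrier (End_ring (Omega k lam))"
      by (intro OGZ_in_End) (simp add: OGZ_def subalgebra_gen_def)
    then show ?case
      using a_inv by (simp add: End_Omega_minus GZ_funs_Omega GZ_funs_uminus)
  qed (auto simp: End_ring_simps compose_def GZ_funs_Omega intro: GZ_funs.add)
qed

section \<open>The dual module\<close>

text \<open>
  The complex dual of the ring. Functionals are extended by \<open>0\<close> to all rational functions, so that
  equal functionals are equal as elements of the type.
\<close>

definition GZ_dual :: "nat \<Rightarrow> (nat \<Rightarrow> nat) \<Rightarrow> mod_elem ring" where
  "GZ_dual k lam = \<lparr>
     carrier = {m. (\<forall>f. f \<notin> GZ_funs k lam \<longrightarrow> m f = 0) \<and>
       (\<forall>f\<in>GZ_funs k lam. \<forall>g\<in>GZ_funs k lam. m (f + g) = m f + m g) \<and>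
       (\<forall>c. \<forall>f\<in>GZ_funs k lam. m (rconst c * f) = c * m f)},
     monoid.mult = (\<lambda>m n. m),
     one = (\<lambda>f. 0),
     ring.zero = (\<lambda>f. 0),
     add = (\<lambda>m n f. m f + n f)\<rparr>"

definition dual_act :: "nat \<Rightarrow> (nat \<Rightarrow> nat) \<Rightarrow> mod_elem \<Rightarrow> (rfun \<Rightarrow> rfun) \<Rightarrow> mod_elem" where
  "dual_act k lam m T = (\<lambda>f. if f \<in> GZ_funs k lam then m (T f) else 0)"

lemma GZ_dual_simps:
  "m \<in> carrier (GZ_dual k lam) \<longleftrightarrow> (\<forall>f. f \<notin> GZ_funs k lam \<longrightarrow> m f = 0) \<and>
     (\<forall>f\<in>GZ_funs k lam. \<forall>g\<in>GZ_funs k lam. m (f + g) = m f + m g) \<and>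
     (\<forall>c. \<forall>f\<in>GZ_funs k lam. m (rconst c * f) = c * m f)"
  "\<zero>\<^bsub>GZ_dual k lam\<^esub> = (\<lambda>f. 0)"
  "m \<oplus>\<^bsub>GZ_dual k lam\<^esub> n = (\<lambda>f. m f + n f)"
  by (simp_all add: GZ_dual_def)

lemma abelian_group_GZ_dual: "abelian_group (GZ_dual k lam)"
proof (rule abelian_groupI)
  fix m assume "m \<in> carrier (GZ_dual k lam)"
  then have "(\<lambda>f. - m f) \<in> carrier (GZ_dual k lam)"
    by (simp add: GZ_dual_simps)
  then show "\<exists>n\<in>carrier (GZ_dual k lam). n \<oplus>\<^bsub>GZ_dual k lam\<^esub> m = \<zero>\<^bsub>GZ_dual k lam\<^esub>"
    by (rule bexI[rotated]) (simp add: GZ_dual_simps)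
qed (auto simp: GZ_dual_simps algebra_simps)

lemma right_module_GZ_dual: "right_module (OGZ k lam) (GZ_dual k lam) (dual_act k lam)"
proof -
  have ops: "(S \<oplus>\<^bsub>OGZ k lam\<^esub> T) f = S f + T f" "(S \<otimes>\<^bsub>OGZ k lam\<^esub> T) f = S (T f)"
    "\<one>\<^bsub>OGZ k lam\<^esub> f = f" if "f \<in> GZ_funs k lam" for S T f
    using GZ_funs_Omega[OF that]
    by (simp_all add: OGZ_def subalgebra_gen_def End_ring_def compose_def)
  have lin: "T (f + g) = T f + T g" "T (rconst c * f) = rconst c * T f"
    if "T \<in> carrier (OGZ k lam)" "f \<in> GZ_funs k lam" "g \<in> GZ_funs k lam" for T f g c
    using OGZ_in_End[OF that(1)] that(2,3)[THEN GZ_funs_Omega] by (auto simp: End_ring_simps)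
  show ?thesis
  proof (intro right_module.intro right_module_axioms.intro ring_OGZ abelian_group_GZ_dual)
    fix m T assume "m \<in> carrier (GZ_dual k lam)" "T \<in> carrier (OGZ k lam)"
    then show "dual_act k lam m T \<in> carrier (GZ_dual k lam)"
      by (auto simp: GZ_dual_simps dual_act_def lin OGZ_preserves_GZ_funs GZ_funs.const
          intro: GZ_funs.add GZ_funs.mult)
  qed (auto simp: fun_eq_iff GZ_dual_simps dual_act_def ops OGZ_preserves_GZ_funs)
qed

theorem corollary4:
  fixes k :: nat and lam :: "nat \<Rightarrow> nat" and \<chi> :: "(rfun \<Rightarrow> rfun) \<Rightarrow> complex"
  assumes "k \<ge> 1"
    and "\<And>i. 1 \<le> i \<Longrightarrow> i \<le> k \<Longrightarrow> lam i \<ge> 1"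
    and "is_character k lam \<chi>"
  shows "\<exists>(M :: mod_elem ring) act m.
    right_module (OGZ k lam) M act \<and> m \<in> carrier M \<and> m \<noteq> \<zero>\<^bsub>M\<^esub> \<and>
    (\<forall>\<gamma>\<in>carrier (GZ_sub k lam). act m \<gamma> = act m (scalar_op (Omega k lam) (\<chi> \<gamma>)))"
proof -
  let ?mul = "mult_op (Omega k lam)"
  define m where "m f = (if f \<in> GZ_funs k lam then \<chi> (?mul f) else 0)" for f
  have hom: "\<chi> \<in> ring_hom (GZ_sub k lam) (ring_of_type_algebra :: complex ring)"
    and scal: "\<And>c T. T \<in> carrier (GZ_sub k lam) \<Longrightarrow>
      \<chi> (scalar_op (Omega k lam) c \<otimes>\<^bsub>GZ_sub k lam\<^esub> T) = c * \<chi> T"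
    using assms(3) by (auto simp: is_character_def)
  have car: "?mul f \<in> carrier (GZ_sub k lam)" if "f \<in> GZ_funs k lam" for f
    using that by (simp add: carrier_GZ_sub)
  have GZ_ops: "?mul f \<otimes>\<^bsub>GZ_sub k lam\<^esub> ?mul g = ?mul (f * g)"
    "?mul f \<oplus>\<^bsub>GZ_sub k lam\<^esub> ?mul g = ?mul (f + g)" "\<one>\<^bsub>GZ_sub k lam\<^esub> = ?mul 1"
    if "g \<in> GZ_funs k lam" for f g
    using mult_op_mult[of g k lam f] mult_op_add[of k lam f g] GZ_funs_Omega[OF that]
    by (simp_all add: GZ_sub_def subalgebra_gen_def End_ring_simps mult_op_def)
  have \<chi>_add: "\<chi> (?mul (f + g)) = \<chi> (?mul f) + \<chi> (?mul g)"
    and \<chi>_mult: "\<chi> (?mul (f * g)) = \<chi> (?mul f) * \<chi> (?mul g)"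
    if "f \<in> GZ_funs k lam" "g \<in> GZ_funs k lam" for f g
    using ring_hom_add[OF hom car car] ring_hom_mult[OF hom car car] that
    by (simp_all add: GZ_ops ring_of_type_algebra_def)
  have \<chi>_1: "\<chi> (?mul 1) = 1"
    using ring_hom_one[OF hom] GZ_ops(3)[OF GZ_funs_1] by (simp add: ring_of_type_algebra_def)
  have \<chi>_scal: "\<chi> (?mul (rconst c * f)) = c * \<chi> (?mul f)" if "f \<in> GZ_funs k lam" for c f
    using scal[OF car[OF that], of c] that by (simp add: scalar_op_def GZ_ops)
  have "m \<in> carrier (GZ_dual k lam)"
    by (auto simp: GZ_dual_simps m_def \<chi>_add \<chi>_scal intro: GZ_funs.add GZ_funs.mult GZ_funs.const)
  moreover have "m \<noteq> \<zero>\<^bsub>GZ_dual k lam\<^esub>"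
  proof
    assume "m = \<zero>\<^bsub>GZ_dual k lam\<^esub>"
    then have "m 1 = 0" by (simp add: GZ_dual_simps)
    then show False by (simp add: m_def GZ_funs_1 \<chi>_1)
  qed
  moreover have "dual_act k lam m T = dual_act k lam m (scalar_op (Omega k lam) (\<chi> T))"
    if T: "T \<in> carrier (GZ_sub k lam)" for T
  proof
    fix f
    obtain g where g: "g \<in> GZ_funs k lam" "T = ?mul g" using T by (auto simp: carrier_GZ_sub)
    show "dual_act k lam m T f = dual_act k lam m (scalar_op (Omega k lam) (\<chi> T)) f"
    proof (cases "f \<in> GZ_funs k lam")
      case True
      then have "T f = g * f" "scalar_op (Omega k lam) (\<chi> T) f = rconst (\<chi> T) * f"
        using g GZ_funs_Omega by (simp_all add: scalar_op_def mult_op_def)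
      moreover have "m (g * f) = \<chi> T * \<chi> (?mul f)"
        using True g by (simp add: m_def \<chi>_mult GZ_funs.mult)
      moreover have "m (rconst (\<chi> T) * f) = \<chi> T * \<chi> (?mul f)"
        using \<chi>_scal[OF True, of "\<chi> T"] True by (simp add: m_def GZ_funs.mult GZ_funs.const)
      ultimately show ?thesis by (simp add: dual_act_def)
    qed (simp add: dual_act_def)
  qed
  ultimately show ?thesis using right_module_GZ_dual by blast
qed

end
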